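(* Let $H=C_a\square C_b$ be the toroidal grid with $a,b\geq 16$, let $n=ab$, and identify $V(H)$ with $[n]$. Then the set of all straight paths in $H$ with $6$ vertices is a resolving set for the Kneser graph $K(n,6)$. Therefore, for such $n$, $\beta(K(n,6))\leq 2n$.
   Context: The toroidal grid $C_a\square C_b$ has vertex set $\mathbb{Z}_a\times\mathbb{Z}_b$, with $(i,j)$ adjacent to $(i\pm1,j)$ and $(i,j\pm1)$. A straight path with $m$ vertices is a vertex set of the form $\{(i,j),(i+1,j),\dots,(i+m-1,j)\}$ or $\{(i,j),(i,j+1),\dots,(i,j+m-1)\}$ (so there are $2ab$ of them for each fixed $m$ smaller than $a,b$). The Kneser graph $K(n,k)$ has as vertices the $k$-subsets of $[n]$, adjacent when disjoint. A resolving set is a set $\mathcal{S}$ of vertices such that for all distinct vertices $U,W$ some $X\in\mathcal{S}$ has $d(U,X)\neq d(W,X)$; $\beta$ is the minimum size of a resolving set. *)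

theory Defs
  imports "Graph_Theory.Graph_Theory"
begin

text \<open>
  As in the Graph Theory library, undirected graphs are symmetric digraphs.
  The library's shortest-path cost with unit weights is then the graph distance,
  with value \<open>\<infinity>\<close> between different components.
\<close>

definition graph_dist :: "('a, 'b) pre_digraph \<Rightarrow> 'a \<Rightarrow> 'a \<Rightarrow> ereal" where
  "graph_dist G u v = wf_digraph.\<mu> G (\<lambda>_. 1) u v"

definition resolving_set :: "('a, 'b) pre_digraph \<Rightarrow> 'a set \<Rightarrow> bool" where
  "resolving_set G S \<longleftrightarrow> S \<subseteq> verts G \<and>
     (\<forall>u\<in>verts G. \<forall>w\<in>verts G. u \<noteq> w \<longrightarrow> (\<exists>x\<in>S. graph_dist G u x \<noteq> graph_dist G w x))"

text \<open>
  Finiteness excludes infinite sets, whose \<open>card\<close> is \<open>0\<close>. For a finite graph the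
  minimum exists, since the set of all vertices is resolving.
\<close>

definition metric_dimension :: "('a, 'b) pre_digraph \<Rightarrow> nat" where
  "metric_dimension G = (LEAST d. \<exists>S. finite S \<and> resolving_set G S \<and> card S = d)"

definition kneser_graph :: "nat \<Rightarrow> nat \<Rightarrow> nat set pair_pre_digraph" where
  "kneser_graph n k =
     \<lparr> pverts = {U. U \<subseteq> {1..n} \<and> card U = k},
       parcs = {(U, W). U \<subseteq> {1..n} \<and> card U = k \<and> W \<subseteq> {1..n} \<and> card W = k \<and> U \<inter> W = {}} \<rparr>"

text \<open>The residues modulo \<open>a\<close> are represented by the integers \<open>0, \<dots>, a - 1\<close>.\<close>

definition toroidal_grid :: "nat \<Rightarrow> nat \<Rightarrow> (int \<times> int) pair_pre_digraph" where
  "toroidal_grid a b =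
     \<lparr> pverts = {0..<int a} \<times> {0..<int b},
       parcs = {((i, j), (i', j')).
          (i, j) \<in> {0..<int a} \<times> {0..<int b} \<and> (i', j') \<in> {0..<int a} \<times> {0..<int b} \<and>
          ((i' = (i + 1) mod int a \<or> i' = (i - 1) mod int a) \<and> j' = j \<or>
           i' = i \<and> (j' = (j + 1) mod int b \<or> j' = (j - 1) mod int b))} \<rparr>"

definition straight_paths :: "nat \<Rightarrow> nat \<Rightarrow> nat \<Rightarrow> (int \<times> int) set set" where
  "straight_paths a b m =
     {{((i + int t) mod int a, j) | t. t < m} | i j. (i, j) \<in> pverts (toroidal_grid a b)} \<union>
     {{(i, (j + int t) mod int b) | t. t < m} | i j. (i, j) \<in> pverts (toroidal_grid a b)}"

lemma pair_graph_kneser_graph: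
  assumes "k \<ge> 1"
  shows "pair_graph (kneser_graph n k)"
proof
  have sub: "{U. U \<subseteq> {1..n} \<and> card U = k} \<subseteq> Pow {1..n}" by auto
  show fv: "finite (pverts (kneser_graph n k))"
    unfolding kneser_graph_def by (simp add: finite_subset[OF sub])
  show arcs: "fst e \<in> pverts (kneser_graph n k)" "snd e \<in> pverts (kneser_graph n k)"
    if "e \<in> parcs (kneser_graph n k)" for e
    using that by (auto simp: kneser_graph_def)
  have "parcs (kneser_graph n k) \<subseteq> pverts (kneser_graph n k) \<times> pverts (kneser_graph n k)"
    using arcs by (auto simp: kneser_graph_def)
  then show "finite (parcs (kneser_graph n k))"
    using fv by (simp add: finite_subset)
  show "symmetric (with_proj (kneser_graph n k))"
    unfolding symmetric_def sym_def with_proj_simps kneser_graph_def by (simp add: Int_commute)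
  show "fst e \<noteq> snd e" if "e \<in> parcs (kneser_graph n k)" for e
  proof -
    have "card (fst e) = k" "fst e \<inter> snd e = {}"
      using that by (cases e; simp add: kneser_graph_def)+
    then show ?thesis using assms by (metis Int_absorb card.empty not_one_le_zero)
  qed
qed

lemma pair_graph_toroidal_grid:
  assumes "a \<ge> 2" "b \<ge> 2"
  shows "pair_graph (toroidal_grid a b)"
proof
  show fv: "finite (pverts (toroidal_grid a b))"
    by (simp add: toroidal_grid_def)
  show arcs: "fst e \<in> pverts (toroidal_grid a b)" "snd e \<in> pverts (toroidal_grid a b)"
    if "e \<in> parcs (toroidal_grid a b)" for e
    using that by (auto simp: toroidal_grid_def)
  have "parcs (toroidal_grid a b) \<subseteq> pverts (toroidal_grid a b) \<times> pverts (toroidal_grid a b)"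
    by (auto simp: toroidal_grid_def)
  then show "finite (parcs (toroidal_grid a b))"
    using fv by (simp add: finite_subset)
  have p: "x = ((x + 1) mod c - 1) mod c" "x = ((x - 1) mod c + 1) mod c"
    if "0 \<le> x" "x < c" for x c :: int
    using that by (simp_all add: mod_diff_left_eq mod_add_left_eq)
  show "symmetric (with_proj (toroidal_grid a b))"
    unfolding symmetric_def sym_def with_proj_simps
  proof (intro allI impI)
    fix u v assume "(u, v) \<in> parcs (toroidal_grid a b)"
    then obtain i j i' j' where uv: "u = (i, j)" "v = (i', j')"
      and m: "0 \<le> i" "i < int a" "0 \<le> j" "j < int b"
        "0 \<le> i'" "i' < int a" "0 \<le> j'" "j' < int b"
      and e: "(i' = (i + 1) mod int a \<or> i' = (i - 1) mod int a) \<and> j' = j \<or>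
           i' = i \<and> (j' = (j + 1) mod int b \<or> j' = (j - 1) mod int b)"
      by (cases u; cases v) (auto simp: toroidal_grid_def)
    have "(i = (i' + 1) mod int a \<or> i = (i' - 1) mod int a) \<and> j = j' \<or>
           i = i' \<and> (j = (j' + 1) mod int b \<or> j = (j' - 1) mod int b)"
      using e p[OF m(1,2)] p[OF m(3,4)] by metis
    then show "(v, u) \<in> parcs (toroidal_grid a b)"
      using m uv by (simp add: toroidal_grid_def)
  qed
  have q: "x \<noteq> (x + 1) mod int c" "x \<noteq> (x - 1) mod int c"
    if "c \<ge> 2" for x :: int and c :: nat
  proof -
    have c: "\<not> int c dvd 1" using that by auto
    show "x \<noteq> (x + 1) mod int c"
    proof
      assume "x = (x + 1) mod int c"
      then have "x mod int c = (x + 1) mod int c" by (metis mod_mod_trivial)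
      then show False using c by (simp add: mod_eq_dvd_iff)
    qed
    show "x \<noteq> (x - 1) mod int c"
    proof
      assume "x = (x - 1) mod int c"
      then have "x mod int c = (x - 1) mod int c" by (metis mod_mod_trivial)
      then show False using c by (simp add: mod_eq_dvd_iff)
    qed
  qed
  show "fst e \<noteq> snd e" if "e \<in> parcs (toroidal_grid a b)" for e
    using that q[OF assms(1)] q[OF assms(2)]
    by (cases e) (fastforce simp: toroidal_grid_def simp del: mod_pos_pos_trivial)
qed

end

theory Submission
  imports Defs
begin

text \<open>
  Two vertices of \<open>K(n, 6)\<close> are at distance \<open>1\<close> exactly if they are disjoint, so it suffices that
  two \<open>6\<close>-sets \<open>U\<close>, \<open>W\<close> of grid points meeting the same straight paths are equal. Let \<open>D\<close> be
  their symmetric difference and \<open>I\<close> their intersection. In a row that meets \<open>D\<close>, either some path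
  misses both sets, and then cutting the cycle there shows that the first and the last point of
  \<open>U \<union> W\<close> both lie in \<open>I\<close>; or both sets meet every path of the row, and then each has at least
  three points in it. Either way the row holds at least five points of \<open>U\<close> and \<open>W\<close>, counted with
  multiplicity, so \<open>D\<close> occupies at most two rows, and similarly at most two columns. Hence every
  such row and column contains at most two points of \<open>D\<close> and, in both cases above, at least two
  points of \<open>I\<close>. As \<open>|D| + 2 |I| = 12\<close>, this leaves no room for a nonempty \<open>D\<close>.
\<close>

section \<open>Distance one in a digraph\<close>

text \<open>The distance is an infimum of walk lengths. The empty walk gives 0 if
  \<open>u = v\<close> is a vertex, even when there is a loop; a walk of length 1 is an arc; in all
  other cases every walk has at least two arcs, or none exists and the infimum is
  \<infinity>.\<close>

lemma (in wf_digraph) graph_dist_eq_1_iff: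
  "graph_dist G u v = 1 \<longleftrightarrow> u \<noteq> v \<and> (u, v) \<in> arcs_ends G"
proof -
  have cost: "awalk_cost (\<lambda>_. 1) p = real (length p)" for p :: "'b list"
    by (simp add: awalk_cost_def sum_list_triv)
  have dist: "graph_dist G u v = (INF p\<in>{p. awalk u p v}. ereal (real (length p)))"
    by (simp add: graph_dist_def \<mu>_def cost)
  show ?thesis
  proof (cases "u \<noteq> v \<and> (u, v) \<in> arcs_ends G")
    case True
    then obtain e where e: "e \<in> arcs G" "tail G e = u" "head G e = v"
      by (auto simp: arcs_ends_def arc_to_ends_def)
    have "graph_dist G u v = 1"
      unfolding dist
    proof (rule antisym)
      show "(INF p\<in>{p. awalk u p v}. ereal (real (length p))) \<le> 1"
        by (rule INF_lower2[of "[e]"]) (use e arc_implies_awalk[of e] in auto)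
      show "1 \<le> (INF p\<in>{p. awalk u p v}. ereal (real (length p)))"
      proof (rule INF_greatest)
        fix p assume "p \<in> {p. awalk u p v}"
        then have "p \<noteq> []" using True by (auto simp: awalk_Nil_iff)
        then show "1 \<le> ereal (real (length p))" by (cases p) auto
      qed
    qed
    then show ?thesis using True by simp
  next
    case no_arc: False
    have "graph_dist G u v \<noteq> 1"
    proof (cases "u = v \<and> u \<in> verts G")
      case True
      then have "graph_dist G u v \<le> 0"
        unfolding dist by (intro INF_lower2[of "[]"]) (auto simp: awalk_Nil_iff)
      then show ?thesis by auto
    next
      case False
      have "2 \<le> graph_dist G u v"
        unfolding dist
      proof (rule INF_greatest)
        fix p assume "p \<in> {p. awalk u p v}"
        then have p: "awalk u p v" by simp
        have "p \<noteq> []" using p False by (auto simp: awalk_Nil_iff)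
        moreover have "p \<noteq> [e]" for e
        proof
          assume "p = [e]"
          then have "(u, v) \<in> arcs_ends G" "u \<in> verts G"
            using p by (auto simp: awalk_Cons_iff awalk_Nil_iff arcs_ends_def arc_to_ends_def)
          then show False using False no_arc by auto
        qed
        ultimately have "2 \<le> length p"
          by (cases p rule: remdups_adj.cases) auto
        then show "2 \<le> ereal (real (length p))" by simp
      qed
      then show ?thesis by auto
    qed
    then show ?thesis using no_arc by blast
  qed
qed

section \<open>Arcs of a cycle and the sets that meet them\<close>

lemma mod_add_left_inj:
  fixes s x y a :: int
  assumes "(s + x) mod a = (s + y) mod a" "0 \<le> x" "x < a" "0 \<le> y" "y < a"
  shows "x = y"
proof -
  have "x mod a = y mod a"
    using assms(1) mod_diff_cong[of "s + x" a "s + y" s s] by simp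
  then show ?thesis using assms by simp
qed

text \<open>This is the moving coordinate of a straight path. The start \<open>i\<close> may be any
  integer, so arcs can be shifted without reducing the start modulo \<open>a\<close>.\<close>

definition cyclic_arc :: "nat \<Rightarrow> nat \<Rightarrow> int \<Rightarrow> int set" where
  "cyclic_arc a m i = {(i + int t) mod int a | t. t < m}"

lemma cyclic_arc_mod: "cyclic_arc a m (i mod int a) = cyclic_arc a m i"
  by (simp add: cyclic_arc_def mod_add_left_eq)

lemma card_cyclic_arc:
  assumes "m \<le> a"
  shows "card (cyclic_arc a m i) = m"
proof -
  have "cyclic_arc a m i = (\<lambda>t. (i + int t) mod int a) ` {..<m}"
    by (auto simp: cyclic_arc_def)
  moreover have "inj_on (\<lambda>t. (i + int t) mod int a) {..<m}"
    using assms by (auto intro!: inj_onI dest!: mod_add_left_inj)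
  ultimately show ?thesis by (simp add: card_image)
qed

text \<open>From a point \<open>s\<close> of \<open>S\<close>, the next \<open>m\<close> positions
  and the \<open>m\<close> positions after those form two disjoint arcs, which do not return to
  \<open>s\<close> because \<open>2 * m < a\<close>. Each contains a further point of
  \<open>S\<close>.\<close>

lemma cyclic_arc_cover_card:
  assumes "finite S" "2 * m < a" and hit: "\<And>i. cyclic_arc a m i \<inter> S \<noteq> {}"
  shows "3 \<le> card S"
proof -
  obtain r where "r \<in> cyclic_arc a m 0 \<inter> S" using hit[of 0] by blast
  \<comment> \<open>The equation records that \<open>s\<close> is reduced modulo \<open>a\<close>,
    so that offset 0 yields \<open>s\<close> itself.\<close>
  then obtain s where s: "s \<in> S" "s = r mod int a"
    by (auto simp: cyclic_arc_def)
  obtain k where k: "k < m" "(s + 1 + int k) mod int a \<in> S"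
    using hit[of "s + 1"] by (auto simp: cyclic_arc_def)
  obtain l where l: "l < m" "(s + 1 + int m + int l) mod int a \<in> S"
    using hit[of "s + 1 + int m"] by (auto simp: cyclic_arc_def)
  let ?f = "\<lambda>t. (s + t) mod int a"
  have "inj_on ?f {0..<int a}"
    by (auto intro!: inj_onI dest!: mod_add_left_inj)
  then have "inj_on ?f {0, 1 + int k, 1 + int m + int l}"
    by (rule inj_on_subset) (use k l assms(2) in auto)
  then have "card (?f ` {0, 1 + int k, 1 + int m + int l}) = card {0, 1 + int k, 1 + int m + int l}"
    by (rule card_image)
  also have "\<dots> = 3" using k l by auto
  finally have "card (?f ` {0, 1 + int k, 1 + int m + int l}) = 3" .
  moreover have "?f ` {0, 1 + int k, 1 + int m + int l} \<subseteq> S"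
    using s k l by (auto simp: add.assoc)
  ultimately show ?thesis using card_mono[OF \<open>finite S\<close>] by metis
qed

text \<open>Cut the cycle at the missed arc. The arc ending at the first point of
  \<open>A \<union> B\<close>, and the one starting at the last, contain no other point of the
  union: they are too short to jump over the missed arc. Both sets meet these arcs, so both points
  are common. If they coincided, \<open>A\<close> and \<open>B\<close> would be the same
  singleton.\<close>

lemma card_Int_if_same_arcs_missed:
  assumes AB: "A \<subseteq> {0..<int a}" "B \<subseteq> {0..<int a}" and "A \<noteq> B" "0 < m"
    and hit: "\<And>i. cyclic_arc a m i \<inter> A = {} \<longleftrightarrow> cyclic_arc a m i \<inter> B = {}"
    and miss: "cyclic_arc a m i0 \<inter> A = {}"
  shows "2 \<le> card (A \<inter> B)"
proof -
  define S where "S = A \<union> B"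
  \<comment> \<open>\<open>f x\<close> is the position of \<open>x\<close> counted from the cut; the
    missed arc occupies positions \<open>0\<close> to \<open>m - 1\<close>.\<close>
  define f where "f x = (x - i0) mod int a" for x
  have fin: "finite S" and ne: "S \<noteq> {}" and sub: "S \<subseteq> {0..<int a}"
    using assms finite_subset[of _ "{0..<int a}"] by (auto simp: S_def)
  have a: "0 < int a" using ne sub by (cases a) auto
  have f_lt: "f x < int a" for x using a by (simp add: f_def)
  have f_inv: "x = (i0 + f x) mod int a" if "x \<in> S" for x
    using that sub by (auto simp: f_def mod_add_right_eq)
  have f_ge: "int m \<le> f x" if x: "x \<in> S" for x
  proof (rule ccontr)
    assume "\<not> int m \<le> f x"
    moreover have "0 \<le> f x" using a by (simp add: f_def)
    ultimately have "x \<in> cyclic_arc a m i0"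
      unfolding cyclic_arc_def using f_inv[OF x]
      by (auto intro!: exI[of _ "nat (f x)"])
    then show False using x miss hit[of i0] by (auto simp: S_def)
  qed
  \<comment> \<open>The arc meets one of the sets in \<open>x\<close>, hence meets the other too,
    and \<open>x\<close> is the only point available.\<close>
  have both: "x \<in> A \<inter> B" if "x \<in> S" "x \<in> cyclic_arc a m i" "cyclic_arc a m i \<inter> S \<subseteq> {x}" for x i
    using that hit[of i] by (auto simp: S_def)
  have fe: "y = x" if "x \<in> S" "y \<in> S" "f y = f x" for x y
    using f_inv[OF that(1)] f_inv[OF that(2)] that(3) by simp
  obtain x where x: "x \<in> S" and x_min: "\<And>y. y \<in> S \<Longrightarrow> f x \<le> f y"
    using fin ne by (metis arg_min_if_finite(1) arg_min_least)
  have "finite (f ` S)" "f ` S \<noteq> {}" using fin ne by auto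
  then have "Max (f ` S) \<in> f ` S" by (rule Max_in)
  then obtain z where z: "z \<in> S" "f z = Max (f ` S)" by auto
  then have z_max: "\<And>y. y \<in> S \<Longrightarrow> f y \<le> f z" using fin by simp
  have "x \<in> A \<inter> B"
  proof (rule both[OF x, of "x - (int m - 1)"])
    show "x \<in> cyclic_arc a m (x - (int m - 1))"
      unfolding cyclic_arc_def using x sub \<open>0 < m\<close>
      by (auto intro!: exI[of _ "m - 1"])
    show "cyclic_arc a m (x - (int m - 1)) \<inter> S \<subseteq> {x}"
    proof
      fix y assume y: "y \<in> cyclic_arc a m (x - (int m - 1)) \<inter> S"
      then obtain t where t: "t < m" "y = (x - (int m - 1) + int t) mod int a"
        by (auto simp: cyclic_arc_def)
      define k where "k = int m - 1 - int t"
      have k: "0 \<le> k" "k < int m" and yk: "y = (x - k) mod int a"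
        using t by (auto simp: k_def algebra_simps)
      have "f y = (x - k - i0) mod int a" by (simp add: f_def yk mod_diff_left_eq)
      also have "\<dots> = (x - i0 - k) mod int a" by (simp add: algebra_simps)
      also have "\<dots> = (f x - k) mod int a" by (simp add: f_def mod_diff_left_eq)
      \<comment> \<open>No wrap-around occurs, as \<open>k < m \<le> f x\<close>.\<close>
      also have "\<dots> = f x - k" using f_ge[OF x] f_lt[of x] k by simp
      finally have "f y = f x" using x_min[of y] y k by auto
      then show "y \<in> {x}" using fe x y by blast
    qed
  qed
  moreover have "z \<in> A \<inter> B"
  proof (rule both[OF z(1), of z])
    show "z \<in> cyclic_arc a m z"
      unfolding cyclic_arc_def using z(1) sub \<open>0 < m\<close>
      by (auto intro!: exI[of _ 0])
    show "cyclic_arc a m z \<inter> S \<subseteq> {z}"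
    proof
      fix y assume y: "y \<in> cyclic_arc a m z \<inter> S"
      then obtain t where t: "t < m" "y = (z + int t) mod int a"
        by (auto simp: cyclic_arc_def)
      have "f y = (z + int t - i0) mod int a" by (simp add: f_def t mod_diff_left_eq)
      also have "\<dots> = (z - i0 + int t) mod int a" by (simp add: algebra_simps)
      also have "\<dots> = (f z + int t) mod int a" by (simp add: f_def mod_add_left_eq)
      finally have fy: "f y = (f z + int t) mod int a" .
      \<comment> \<open>Passing the cut would place \<open>y\<close> at a position below
        \<open>t < m\<close>, inside the missed arc.\<close>
      have "f z + int t < int a"
      proof (rule ccontr)
        assume "\<not> f z + int t < int a"
        then have "f y = (f z + int t - int a) mod int a" "0 \<le> f z + int t - int a"
          unfolding fy by (simp_all only: mod_diff_right_eq minus_mod_self2)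
        then have "f y \<le> f z + int t - int a" by (metis zmod_le_nonneg_dividend)
        then show False using f_ge[of y] f_lt[of z] t y by auto
      qed
      then have "f y = f z + int t" using fy f_ge[OF z(1)] by simp
      then have "f y = f z" using z_max[of y] y by auto
      then show "y \<in> {z}" using fe z y by blast
    qed
  qed
  moreover have "x \<noteq> z"
  proof
    assume "x = z"
    then have "f y = f x" if "y \<in> S" for y
      using x_min[OF that] z_max[OF that] by simp
    then have "S \<subseteq> {x}" using fe x by blast
    then show False using \<open>x \<in> A \<inter> B\<close> \<open>A \<noteq> B\<close> by (auto simp: S_def)
  qed
  ultimately have "{x, z} \<subseteq> A \<inter> B" "card {x, z} = 2" by auto
  moreover have "finite (A \<inter> B)" using fin by (simp add: S_def)
  ultimately show ?thesis by (metis card_mono)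
qed

text \<open>If an arc misses one set, it misses both and provides the cut; otherwise each set meets
  every arc and so has three points.\<close>

lemma card_if_same_arcs_missed:
  assumes "A \<subseteq> {0..<int a}" "B \<subseteq> {0..<int a}" "A \<noteq> B" "0 < m" "2 * m < a"
    and hit: "\<And>i. cyclic_arc a m i \<inter> A = {} \<longleftrightarrow> cyclic_arc a m i \<inter> B = {}"
  shows "2 \<le> card (A \<inter> B) \<or> 3 \<le> card A \<and> 3 \<le> card B"
proof (cases "\<exists>i. cyclic_arc a m i \<inter> A = {}")
  case True
  then show ?thesis using card_Int_if_same_arcs_missed[OF assms(1-4) hit] by blast
next
  case False
  have "finite A" "finite B" using assms(1,2) finite_subset[of _ "{0..<int a}"] by auto
  then show ?thesis using cyclic_arc_cover_card[OF _ \<open>2 * m < a\<close>] False hit by blast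
qed

section \<open>Counting points by rows and columns\<close>

lemma card_fibres:
  assumes "finite U" "finite Y"
  shows "card {x \<in> U. p x \<in> Y} = (\<Sum>y\<in>Y. card {x \<in> U. p x = y})"
proof -
  have "{x \<in> U. p x \<in> Y} = (\<Union>y\<in>Y. {x \<in> U. p x = y})" by auto
  then show ?thesis using assms by (auto intro!: card_UN_disjoint)
qed

lemma card_sym_diff:
  assumes "finite U" "finite W"
  shows "card (sym_diff U W) + 2 * card (U \<inter> W) = card U + card W"
proof -
  have "card (sym_diff U W) = card (U - W) + card (W - U)"
    using assms by (intro card_Un_disjoint) auto
  moreover have "card U = card (U - W) + card (U \<inter> W)" "card W = card (W - U) + card (U \<inter> W)"
    using assms card_Diff_subset_Int[of U W] card_Diff_subset_Int[of W U]
      card_mono[of U "U \<inter> W"] card_mono[of W "U \<inter> W"] by (auto simp: Int_commute)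
  ultimately show ?thesis by simp
qed

text \<open>A fibre with a point of the symmetric difference has size sum at least
  \<open>1 + 2 * 2 = 5\<close> in the first alternative and \<open>3 + 3\<close> in the second, so
  three such fibres would need 15 points.\<close>

lemma few_sym_diff_fibres:
  assumes fin: "finite U" "finite W" and "card U + card W < 15"
    and large: "\<And>y. y \<in> p ` sym_diff U W \<Longrightarrow>
      2 \<le> card {x \<in> U \<inter> W. p x = y} \<or> 3 \<le> card {x \<in> U. p x = y} \<and> 3 \<le> card {x \<in> W. p x = y}"
  shows "card (p ` sym_diff U W) \<le> 2"
proof -
  let ?Y = "p ` sym_diff U W"
  have "5 \<le> card {x \<in> U. p x = y} + card {x \<in> W. p x = y}" if y: "y \<in> ?Y" for y
  proof -
    have "card (sym_diff {x \<in> U. p x = y} {x \<in> W. p x = y}) \<noteq> 0"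
      using y fin by (auto simp: card_eq_0_iff)
    moreover have "card (sym_diff {x \<in> U. p x = y} {x \<in> W. p x = y}) +
        2 * card ({x \<in> U. p x = y} \<inter> {x \<in> W. p x = y}) =
        card {x \<in> U. p x = y} + card {x \<in> W. p x = y}"
      using fin by (intro card_sym_diff) auto
    moreover have "{x \<in> U. p x = y} \<inter> {x \<in> W. p x = y} = {x \<in> U \<inter> W. p x = y}" by auto
    then have "card ({x \<in> U. p x = y} \<inter> {x \<in> W. p x = y}) = card {x \<in> U \<inter> W. p x = y}"
      by (rule arg_cong)
    ultimately show ?thesis using large[OF y] by linarith
  qed
  then have "(\<Sum>y\<in>?Y. 5) \<le> (\<Sum>y\<in>?Y. card {x \<in> U. p x = y} + card {x \<in> W. p x = y})"
    by (rule sum_mono)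
  also have "\<dots> = card {x \<in> U. p x \<in> ?Y} + card {x \<in> W. p x \<in> ?Y}"
    using fin by (simp add: card_fibres sum.distrib)
  also have "\<dots> \<le> card U + card W"
    using fin by (intro add_mono card_mono) auto
  finally show ?thesis using assms(3) by simp
qed

text \<open>Here \<open>p\<close> and \<open>q\<close> play the two coordinates: \<open>q\<close> is
  injective on a fibre of \<open>p\<close>, so the fibre has at most two points of the symmetric
  difference. If both sets have three points there, removing these two from the total of at least
  six leaves two common points, each counted twice.\<close>

lemma many_common_points:
  assumes fin: "finite U" "finite W" and inj: "inj_on q {x \<in> sym_diff U W. p x = y}"
    and q: "card (q ` sym_diff U W) \<le> 2"
    and large: "2 \<le> card {x \<in> U \<inter> W. p x = y} \<or>
      3 \<le> card {x \<in> U. p x = y} \<and> 3 \<le> card {x \<in> W. p x = y}"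
  shows "2 \<le> card {x \<in> U \<inter> W. p x = y}"
proof -
  have "card {x \<in> sym_diff U W. p x = y} \<le> card (q ` sym_diff U W)"
    using inj fin by (intro card_inj_on_le[of q]) auto
  moreover have "{x \<in> sym_diff U W. p x = y} = sym_diff {x \<in> U. p x = y} {x \<in> W. p x = y}"
    "{x \<in> U. p x = y} \<inter> {x \<in> W. p x = y} = {x \<in> U \<inter> W. p x = y}" by auto
  ultimately show ?thesis
    using card_sym_diff[of "{x \<in> U. p x = y}" "{x \<in> W. p x = y}"] large fin q by auto
qed

text \<open>Each column in \<open>X\<close> and each row in \<open>Y\<close> demands two points of
  \<open>I\<close>. Points serving both a column and a row compete with \<open>D\<close> for places
  in \<open>X \<times> Y\<close>, which has at most four.\<close>

lemma grid_six_sets_eq: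
  fixes U W :: "('a \<times> 'b) set"
  assumes card: "card U = 6" "card W = 6"
    and cols: "\<And>x. x \<in> fst ` sym_diff U W \<Longrightarrow>
      2 \<le> card {u \<in> U \<inter> W. fst u = x} \<or> 3 \<le> card {u \<in> U. fst u = x} \<and> 3 \<le> card {u \<in> W. fst u = x}"
    and rows: "\<And>y. y \<in> snd ` sym_diff U W \<Longrightarrow>
      2 \<le> card {u \<in> U \<inter> W. snd u = y} \<or> 3 \<le> card {u \<in> U. snd u = y} \<and> 3 \<le> card {u \<in> W. snd u = y}"
  shows "U = W"
proof (rule ccontr)
  assume "U \<noteq> W"
  define D where "D = sym_diff U W"
  define I where "I = U \<inter> W"
  define X where "X = fst ` D"
  define Y where "Y = snd ` D"
  have fin: "finite U" "finite W" using card by (auto intro: card_ge_0_finite)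
  then have finD: "finite D" "finite I" "finite X" "finite Y" by (auto simp: D_def I_def X_def Y_def)
  have X2: "card X \<le> 2" and Y2: "card Y \<le> 2"
    unfolding X_def Y_def D_def using few_sym_diff_fibres[OF fin] card cols rows by auto
  have "2 \<le> card {u \<in> I. fst u = x}" if "x \<in> X" for x
    unfolding I_def using that Y2 cols
    by (intro many_common_points[OF fin, of snd]) (auto simp: X_def Y_def D_def inj_on_def)
  then have "(\<Sum>x\<in>X. 2) \<le> (\<Sum>x\<in>X. card {u \<in> I. fst u = x})" by (rule sum_mono)
  then have IX: "2 * card X \<le> card {u \<in> I. fst u \<in> X}"
    using finD by (simp add: card_fibres)
  have "2 \<le> card {u \<in> I. snd u = y}" if "y \<in> Y" for y
    unfolding I_def using that X2 rows
    by (intro many_common_points[OF fin, of fst]) (auto simp: X_def Y_def D_def inj_on_def)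
  then have "(\<Sum>y\<in>Y. 2) \<le> (\<Sum>y\<in>Y. card {u \<in> I. snd u = y})" by (rule sum_mono)
  then have IY: "2 * card Y \<le> card {u \<in> I. snd u \<in> Y}"
    using finD by (simp add: card_fibres)
  have DXY: "D \<subseteq> X \<times> Y" by (force simp: X_def Y_def)
  \<comment> \<open>This bounds the overlap in the inclusion-exclusion count below: points of
    \<open>I\<close> counted by column and by row share \<open>X \<times> Y\<close> with the
    disjoint set \<open>D\<close>.\<close>
  have "{u \<in> I. fst u \<in> X} \<inter> {u \<in> I. snd u \<in> Y} \<union> D \<subseteq> X \<times> Y"
    using DXY by auto
  then have "card ({u \<in> I. fst u \<in> X} \<inter> {u \<in> I. snd u \<in> Y} \<union> D) \<le> card X * card Y"
    using finD card_mono[of "X \<times> Y"] by (simp add: card_cartesian_product)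
  moreover have "card ({u \<in> I. fst u \<in> X} \<inter> {u \<in> I. snd u \<in> Y} \<union> D) =
      card ({u \<in> I. fst u \<in> X} \<inter> {u \<in> I. snd u \<in> Y}) + card D"
    using finD by (intro card_Un_disjoint) (auto simp: I_def D_def intro: finite_subset[of _ "U \<inter> W"])
  moreover have "card {u \<in> I. fst u \<in> X} + card {u \<in> I. snd u \<in> Y} =
      card ({u \<in> I. fst u \<in> X} \<union> {u \<in> I. snd u \<in> Y}) + card ({u \<in> I. fst u \<in> X} \<inter> {u \<in> I. snd u \<in> Y})"
    using finD by (intro card_Un_Int) auto
  moreover have "card ({u \<in> I. fst u \<in> X} \<union> {u \<in> I. snd u \<in> Y}) \<le> card I"
    using finD by (intro card_mono) auto
  ultimately have le: "2 * card X + 2 * card Y + card D \<le> card I + card X * card Y"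
    using IX IY by linarith
  have "D \<noteq> {}" using \<open>U \<noteq> W\<close> by (auto simp: D_def)
  then have "card D \<noteq> 0" using finD by simp
  moreover have "card D + 2 * card I = 12"
    using card_sym_diff[OF fin] card by (simp add: D_def I_def)
  moreover have "card X \<in> {0, 1, 2}" "card Y \<in> {0, 1, 2}" using X2 Y2 by auto
  moreover have "card D \<le> card X * card Y"
    using finD card_mono[OF _ DXY] by (simp add: card_cartesian_product)
  \<comment> \<open>\<open>card D\<close> is even, being \<open>12 - 2 * card I\<close>, and
    positive. If \<open>X\<close> and \<open>Y\<close> are singletons,
    \<open>card D \<le> 1\<close>. If one has two elements and the other one or two,
    \<open>le\<close> gives \<open>card I \<ge> card D + 4\<close>, hence
    \<open>3 * card D \<le> 4\<close>. If one is empty, so is \<open>D\<close>.\<close>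
  ultimately show False using le by (auto; presburger)
qed

section \<open>Straight paths separate six-sets of the grid\<close>

text \<open>The product form reduces meeting a path to meeting an arc within one row or column, and
  the images of the grid give finiteness and the bound on the number of paths.\<close>

lemma straight_paths_eq:
  "straight_paths a b m =
    (\<lambda>(i, j). cyclic_arc a m i \<times> {j}) ` ({0..<int a} \<times> {0..<int b}) \<union>
    (\<lambda>(i, j). {i} \<times> cyclic_arc b m j) ` ({0..<int a} \<times> {0..<int b})"
proof -
  have "{((i + int t) mod int a, j) | t. t < m} = cyclic_arc a m i \<times> {j}"
    "{(i, (j + int t) mod int b) | t. t < m} = {i} \<times> cyclic_arc b m j" for i j
    by (auto simp: cyclic_arc_def)
  then show ?thesis
    unfolding straight_paths_def by (auto simp: toroidal_grid_def image_iff) blast+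
qed

text \<open>The paths in a fixed row or column cut out all arcs of six points there, so the
  dichotomy for cycles applies to each line that meets the symmetric difference. The bound 13
  expresses \<open>2 * 6 < a\<close> and \<open>2 * 6 < b\<close>.\<close>

lemma straight_paths_separate:
  assumes "13 \<le> a" "13 \<le> b"
    and sub: "U \<subseteq> {0..<int a} \<times> {0..<int b}" "W \<subseteq> {0..<int a} \<times> {0..<int b}"
    and card: "card U = 6" "card W = 6"
    and hit: "\<And>P. P \<in> straight_paths a b 6 \<Longrightarrow> P \<inter> U = {} \<longleftrightarrow> P \<inter> W = {}"
  shows "U = W"
proof (rule grid_six_sets_eq[OF card])
  fix x assume "x \<in> fst ` sym_diff U W"
  define col where "col S = {y. (x, y) \<in> S}" for S :: "(int \<times> int) set"
  have x: "x \<in> {0..<int a}" and ne: "col U \<noteq> col W"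
    using \<open>x \<in> _\<close> sub by (auto simp: col_def)
  have fib: "card {u \<in> S. fst u = x} = card (col S)" for S
    by (rule bij_betw_same_card[of snd]) (force simp: bij_betw_def inj_on_def col_def)
  have "2 \<le> card (col U \<inter> col W) \<or> 3 \<le> card (col U) \<and> 3 \<le> card (col W)"
  proof (rule card_if_same_arcs_missed[OF _ _ ne, of b 6])
    show "cyclic_arc b 6 i \<inter> col U = {} \<longleftrightarrow> cyclic_arc b 6 i \<inter> col W = {}" for i
    proof -
      \<comment> \<open>A path starts at a grid point, whereas \<open>i\<close> is any integer;
        reducing \<open>i\<close> leaves the arc unchanged.\<close>
      have "{x} \<times> cyclic_arc b 6 (i mod int b) \<in> straight_paths a b 6"
        using x \<open>13 \<le> b\<close> unfolding straight_paths_eq by (auto intro!: image_eqI[of _ _ "(x, i mod int b)"])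
      from hit[OF this] show ?thesis by (auto simp: cyclic_arc_mod col_def)
    qed
  qed (use sub assms in \<open>auto simp: col_def\<close>)
  moreover have "col U \<inter> col W = col (U \<inter> W)" by (auto simp: col_def)
  ultimately show "2 \<le> card {u \<in> U \<inter> W. fst u = x} \<or>
      3 \<le> card {u \<in> U. fst u = x} \<and> 3 \<le> card {u \<in> W. fst u = x}"
    by (simp only: fib)
next
  fix y assume "y \<in> snd ` sym_diff U W"
  define row where "row S = {x. (x, y) \<in> S}" for S :: "(int \<times> int) set"
  have y: "y \<in> {0..<int b}" and ne: "row U \<noteq> row W"
    using \<open>y \<in> _\<close> sub by (auto simp: row_def)
  have fib: "card {u \<in> S. snd u = y} = card (row S)" for S
    by (rule bij_betw_same_card[of fst]) (force simp: bij_betw_def inj_on_def row_def)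
  have "2 \<le> card (row U \<inter> row W) \<or> 3 \<le> card (row U) \<and> 3 \<le> card (row W)"
  proof (rule card_if_same_arcs_missed[OF _ _ ne, of a 6])
    show "cyclic_arc a 6 i \<inter> row U = {} \<longleftrightarrow> cyclic_arc a 6 i \<inter> row W = {}" for i
    proof -
      have "cyclic_arc a 6 (i mod int a) \<times> {y} \<in> straight_paths a b 6"
        using y \<open>13 \<le> a\<close> unfolding straight_paths_eq by (auto intro!: image_eqI[of _ _ "(i mod int a, y)"])
      from hit[OF this] show ?thesis by (auto simp: cyclic_arc_mod row_def)
    qed
  qed (use sub assms in \<open>auto simp: row_def\<close>)
  moreover have "row U \<inter> row W = row (U \<inter> W)" by (auto simp: row_def)
  ultimately show "2 \<le> card {u \<in> U \<inter> W. snd u = y} \<or>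
      3 \<le> card {u \<in> U. snd u = y} \<and> 3 \<le> card {u \<in> W. snd u = y}"
    by (simp only: fib)
qed

lemma straight_path_in_grid:
  assumes "P \<in> straight_paths a b m" "m \<le> a" "m \<le> b"
  shows "P \<subseteq> {0..<int a} \<times> {0..<int b}" "card P = m"
proof -
  have "cyclic_arc c m i \<subseteq> {0..<int c}" if "i \<in> {0..<int c}" for c i
    using that by (auto simp: cyclic_arc_def)
  then show "P \<subseteq> {0..<int a} \<times> {0..<int b}" "card P = m"
    using assms unfolding straight_paths_eq
    by (fastforce, auto simp: card_cartesian_product card_cyclic_arc)
qed

lemma finite_straight_paths: "finite (straight_paths a b m)"
  by (simp add: straight_paths_eq)

lemma card_straight_paths: "card (straight_paths a b m) \<le> 2 * (a * b)"
proof -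
  let ?V = "{0..<int a} \<times> {0..<int b}"
  have "card (f ` ?V) \<le> a * b" for f :: "int \<times> int \<Rightarrow> (int \<times> int) set"
    using card_image_le[of ?V f] by (simp add: card_cartesian_product)
  then show ?thesis
    unfolding straight_paths_eq mult_2 by (meson add_mono card_Un_le order_trans)
qed

section \<open>Transfer to the Kneser graph\<close>

text \<open>As \<open>k \<ge> 1\<close>, disjoint \<open>k\<close>-sets are distinct, so
  disjointness alone describes adjacency.\<close>

lemma graph_dist_kneser_eq_1_iff:
  assumes "k \<ge> 1" "U \<in> pverts (kneser_graph n k)" "W \<in> pverts (kneser_graph n k)"
  shows "graph_dist (with_proj (kneser_graph n k)) U W = 1 \<longleftrightarrow> U \<inter> W = {}"
proof -
  interpret pair_graph "kneser_graph n k" by (rule pair_graph_kneser_graph[OF assms(1)])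
  have "U \<noteq> W" if "U \<inter> W = {}" using that assms by (auto simp: kneser_graph_def)
  then show ?thesis
    using assms(2,3) unfolding graph_dist_eq_1_iff with_proj_simps
    by (auto simp: kneser_graph_def)
qed

text \<open>The injection \<phi> preserves sizes and disjointness. A path meeting exactly one of two
  six-sets therefore becomes a vertex at distance 1 from exactly one of their images.\<close>

lemma resolving_set_straight_paths:
  assumes ab: "13 \<le> a" "13 \<le> b" and \<phi>: "bij_betw \<phi> (pverts (toroidal_grid a b)) {1..a * b}"
  shows "resolving_set (with_proj (kneser_graph (a * b) 6)) ((`) \<phi> ` straight_paths a b 6)"
proof -
  let ?V = "{0..<int a} \<times> {0..<int b}"
  let ?K = "kneser_graph (a * b) 6"
  have inj: "inj_on \<phi> ?V" and im: "\<phi> ` ?V = {1..a * b}"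
    using \<phi> by (auto simp: bij_betw_def toroidal_grid_def)
  have vert: "\<phi> ` P \<in> pverts ?K" if P: "P \<in> straight_paths a b 6" for P
  proof -
    have PV: "P \<subseteq> ?V" "card P = 6" using straight_path_in_grid[OF P] ab by auto
    then have "card (\<phi> ` P) = 6" using inj card_image inj_on_subset by metis
    moreover have "\<phi> ` P \<subseteq> {1..a * b}" unfolding im[symmetric] using PV(1) by (rule image_mono)
    ultimately show ?thesis by (simp add: kneser_graph_def)
  qed
  have pull: "\<exists>A \<subseteq> ?V. card A = 6 \<and> \<phi> ` A = U" if U: "U \<in> pverts ?K" for U
  proof -
    have "U \<subseteq> \<phi> ` ?V" "card U = 6" using U im by (auto simp: kneser_graph_def)
    then obtain A where A: "A \<subseteq> ?V" "U = \<phi> ` A" by (auto simp: subset_image_iff)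
    then have "card A = 6" using \<open>card U = 6\<close> inj card_image inj_on_subset by metis
    then show ?thesis using A by blast
  qed
  show ?thesis
    unfolding resolving_set_def with_proj_simps
  proof (intro conjI ballI impI)
    show "(`) \<phi> ` straight_paths a b 6 \<subseteq> pverts ?K" using vert by auto
    fix U W assume UW: "U \<in> pverts ?K" "W \<in> pverts ?K" "U \<noteq> W"
    obtain A where A: "A \<subseteq> ?V" "card A = 6" "\<phi> ` A = U" using pull[OF UW(1)] by blast
    obtain B where B: "B \<subseteq> ?V" "card B = 6" "\<phi> ` B = W" using pull[OF UW(2)] by blast
    have "A \<noteq> B" using A B UW(3) by auto
    then obtain P where P: "P \<in> straight_paths a b 6"
      and sep: "\<not> (P \<inter> A = {} \<longleftrightarrow> P \<inter> B = {})"
      using straight_paths_separate[OF ab A(1) B(1) A(2) B(2)] by blast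
    have PV: "P \<subseteq> ?V" using straight_path_in_grid[OF P] ab by auto
    have "U \<inter> \<phi> ` P = {} \<longleftrightarrow> P \<inter> A = {}" "W \<inter> \<phi> ` P = {} \<longleftrightarrow> P \<inter> B = {}"
      using inj_on_image_Int[OF inj PV A(1)] inj_on_image_Int[OF inj PV B(1)] A(3) B(3)
      by (auto simp: Int_commute)
    then have "graph_dist ?K U (\<phi> ` P) \<noteq> graph_dist ?K W (\<phi> ` P)"
      using sep graph_dist_kneser_eq_1_iff[OF _ UW(1) vert[OF P]]
        graph_dist_kneser_eq_1_iff[OF _ UW(2) vert[OF P]] by auto
    then show "\<exists>X\<in>(`) \<phi> ` straight_paths a b 6. graph_dist ?K U X \<noteq> graph_dist ?K W X"
      using P by blast
  qed
qed

theorem theorem4p9: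
  fixes a b n :: nat
  assumes "a \<ge> 16" and "b \<ge> 16" and "n = a * b"
  shows "(\<forall>\<phi>. bij_betw \<phi> (pverts (toroidal_grid a b)) {1..n} \<longrightarrow>
            resolving_set (with_proj (kneser_graph n 6)) ((\<lambda>P. \<phi> ` P) ` straight_paths a b 6)) \<and>
         metric_dimension (with_proj (kneser_graph n 6)) \<le> 2 * n"
proof
  have res: "resolving_set (with_proj (kneser_graph n 6)) ((`) \<phi> ` straight_paths a b 6)"
    if "bij_betw \<phi> (pverts (toroidal_grid a b)) {1..n}" for \<phi>
    using resolving_set_straight_paths[of a b \<phi>] that assms by simp
  then show "\<forall>\<phi>. bij_betw \<phi> (pverts (toroidal_grid a b)) {1..n} \<longrightarrow>
      resolving_set (with_proj (kneser_graph n 6)) ((\<lambda>P. \<phi> ` P) ` straight_paths a b 6)"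
    by simp
  \<comment> \<open>The bound on the metric dimension needs one concrete identification of the grid
    with \<open>{1..n}\<close>, which exists because both have \<open>a * b\<close>
    elements.\<close>
  have "card (pverts (toroidal_grid a b)) = card {1..n}" "finite (pverts (toroidal_grid a b))"
    by (simp_all add: toroidal_grid_def card_cartesian_product assms(3))
  then obtain \<phi> where \<phi>: "bij_betw \<phi> (pverts (toroidal_grid a b)) {1..n}"
    using finite_same_card_bij by blast
  let ?S = "(`) \<phi> ` straight_paths a b 6"
  have "metric_dimension (with_proj (kneser_graph n 6)) \<le> card ?S"
    unfolding metric_dimension_def
    by (rule Least_le) (use res[OF \<phi>] finite_straight_paths in blast)
  also have "\<dots> \<le> card (straight_paths a b 6)"
    by (rule card_image_le[OF finite_straight_paths])
  also have "\<dots> \<le> 2 * n" using card_straight_paths assms(3) by simp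
  finally show "metric_dimension (with_proj (kneser_graph n 6)) \<le> 2 * n" .
qed

end
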